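(* Let $V\in\mathbb{R}_+^{m\times n}$, put $P=V$, and let $\mathbf{Q}_1\in\boldsymbol{\mathcal{Q}}$ have strictly positive elements, $\mathbf{Q}_1(ilj)=W^1_{il}H^1_{lj}$ with $H^1$ row stochastic. Define recursively, for $t\ge 1$, $$\mathbf{P}_t=\mathbf{P}^*(\mathbf{Q}_t),\qquad \mathbf{Q}_{t+1}=\mathbf{Q}^*(\mathbf{P}_t),$$ where $\mathbf{P}^*(\cdot)$ and $\mathbf{Q}^*(\cdot)$ are the partial minimization maps defined in the context. Write $\mathbf{Q}_t(ilj)=W^t_{il}H^t_{lj}$, where for $t\ge2$ the factors $W^t,H^t$ are the factors $Q^*_-,Q^*_+$ of $\mathbf{Q}^*(\mathbf{P}_{t-1})$, and let $Q_t=W^tH^t$, i.e. $Q_t(ij)=\sum_l\mathbf{Q}_t(ilj)$. Then for every $t\ge1$: (1) for all $i,l$, $$W^{t+1}_{il}=\sum_jV_{ij}\frac{W^t_{il}H^t_{lj}}{(W^tH^t)_{ij}},$$ and, for all $j$ and all $l$ for which the denominator below is positive, $$H^{t+1}_{lj}=\frac{\sum_iV_{ij}\,W^t_{il}H^t_{lj}/(W^tH^t)_{ij}}{\sum_i\sum_{j'}V_{ij'}\,W^t_{il}H^t_{lj'}/(W^tH^t)_{ij'}};$$ (2) $$D(P\|Q_t)=D(\mathbf{P}_t\|\mathbf{P}_{t+1})+D(P\|Q_{t+1})+D(\mathbf{Q}_{t+1}\|\mathbf{Q}_t),$$ and in particular $D(P\|Q_t)\ge D(P\|Q_{t+1})$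.
   Context: Integers $m,n\ge 1$ and $1\le k\le\min(m,n)$ are fixed; $\mathbb{R}_+=[0,\infty)$. Indices range over $i\in\{1,\dots,m\}$, $l\in\{1,\dots,k\}$, $j,j'\in\{1,\dots,n\}$. The convention $0/0=0$ is used throughout. For two nonnegative arrays $M=(M_\alpha)$, $N=(N_\alpha)$ of the same shape (vectors, matrices or three-index arrays), the I-divergence is $$D(M\|N)=\sum_{\alpha}\Big(M_\alpha\log\frac{M_\alpha}{N_\alpha}-M_\alpha+N_\alpha\Big)\in[0,\infty],$$ with the conventions $0/0=0$, $0\log 0=0$ and $p/0=\infty$ for $p>0$ (so a term with $M_\alpha=0$ equals $N_\alpha$, and a term with $M_\alpha>0$, $N_\alpha=0$ equals $+\infty$). Given $P\in\mathbb{R}_+^{m\times n}$, define $$\boldsymbol{\mathcal{P}}=\Big\{\mathbf{P}\in\mathbb{R}_+^{m\times k\times n}:\ \sum_l\mathbf{P}(ilj)=P(ij)\ \text{for all } i,j\Big\},$$ $$\boldsymbol{\mathcal{Q}}=\Big\{\mathbf{Q}\in\mathbb{R}_+^{m\times k\times n}:\ \mathbf{Q}(ilj)=Q_-(il)Q_+(lj)\ \text{for some } Q_-\in\mathbb{R}_+^{m\times k},\ Q_+\in\mathbb{R}_+^{k\times n}\text{ with }\sum_jQ_+(lj)=1\ \text{for all } l\Big\}.$$ For $\mathbf{Q}\in\boldsymbol{\mathcal{Q}}$ with $Q(ij)=\sum_l\mathbf{Q}(ilj)$, the array $\mathbf{P}^*(\mathbf{Q})$ (the minimizer of $\mathbf{P}\mapsto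 D(\mathbf{P}\|\mathbf{Q})$ over $\boldsymbol{\mathcal{P}}$) is $$\mathbf{P}^*(ilj)=\frac{\mathbf{Q}(ilj)P(ij)}{Q(ij)}.$$ For $\mathbf{P}\in\boldsymbol{\mathcal{P}}$, the array $\mathbf{Q}^*(\mathbf{P})$ (the minimizer of $\mathbf{Q}\mapsto D(\mathbf{P}\|\mathbf{Q})$ over $\boldsymbol{\mathcal{Q}}$) is $\mathbf{Q}^*(ilj)=Q^*_-(il)Q^*_+(lj)$ with $$Q^*_-(il)=\sum_j\mathbf{P}(ilj),\qquad Q^*_+(lj)=\frac{\sum_i\mathbf{P}(ilj)}{\sum_{i,j'}\mathbf{P}(ilj')},$$ where, if the last denominator vanishes for some $l$, the row $Q^*_+(l\,\cdot)$ is taken to be an arbitrary probability vector (this does not affect $\mathbf{Q}^*$, since then $Q^*_-(il)=0$ for all $i$). *)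

theory Defs
  imports "HOL-Analysis.Analysis"
begin

text \<open>
  The index sets \<open>{1..m}\<close>, \<open>{1..k}\<close>, \<open>{1..n}\<close> are finite types \<open>'m\<close>, \<open>'k\<close>, \<open>'n\<close>. A matrix in
  \<open>R^(m x n)\<close> has type \<open>real^'n^'m\<close>, so \<open>M $ i $ j\<close> is its entry in row \<open>i\<close>, column \<open>j\<close>; an array in
  \<open>R^(m x k x n)\<close> has type \<open>real^'n^'k^'m\<close>, with entries \<open>A $ i $ l $ j\<close>.

  The convention \<open>0 / 0 = 0\<close> is that of HOL's division. The other convention, \<open>p / 0 = \<infinity>\<close> for
  \<open>p > 0\<close>, occurs only inside the divergence and is built into \<open>idiv_term\<close>.
\<close>

section \<open>I-divergence\<close>

definition idiv_term :: "real \<Rightarrow> real \<Rightarrow> ereal" where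
  "idiv_term p q =
     (if p = 0 then ereal q else if q = 0 then \<infinity> else ereal (p * ln (p / q) - p + q))"

definition Idiv :: "('a::finite \<Rightarrow> real) \<Rightarrow> ('a \<Rightarrow> real) \<Rightarrow> ereal" where
  "Idiv M N = (\<Sum>a\<in>UNIV. idiv_term (M a) (N a))"

definition Idiv2 :: "real^'n^'m \<Rightarrow> real^'n^'m \<Rightarrow> ereal" where
  "Idiv2 M N = Idiv (\<lambda>(i, j). M $ i $ j) (\<lambda>(i, j). N $ i $ j)"

definition Idiv3 :: "real^'n^'k^'m \<Rightarrow> real^'n^'k^'m \<Rightarrow> ereal" where
  "Idiv3 M N = Idiv (\<lambda>(i, l, j). M $ i $ l $ j) (\<lambda>(i, l, j). N $ i $ l $ j)"

section \<open>The two families of arrays\<close>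

definition row_stochastic :: "real^'n^'k \<Rightarrow> bool" where
  "row_stochastic H \<longleftrightarrow> (\<forall>l j. 0 \<le> H $ l $ j) \<and> (\<forall>l. (\<Sum>j\<in>UNIV. H $ l $ j) = 1)"

definition factor_array :: "real^'k^'m \<Rightarrow> real^'n^'k \<Rightarrow> real^'n^'k^'m" where
  "factor_array W H = (\<chi> i l j. W $ i $ l * H $ l $ j)"

definition marginal :: "real^'n^'k^'m \<Rightarrow> real^'n^'m" where
  "marginal A = (\<chi> i j. \<Sum>l\<in>UNIV. A $ i $ l $ j)"

definition P_set :: "real^'n^'m \<Rightarrow> (real^'n^'k^'m) set" where
  "P_set P = {A. (\<forall>i l j. 0 \<le> A $ i $ l $ j) \<and> (\<forall>i j. (\<Sum>l\<in>UNIV. A $ i $ l $ j) = P $ i $ j)}"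

definition Q_set :: "(real^'n^'k^'m) set" where
  "Q_set = {factor_array W H | W H. (\<forall>i l. 0 \<le> W $ i $ l) \<and> row_stochastic H}"

section \<open>The partial minimization maps\<close>

definition Pstar :: "real^'n^'m \<Rightarrow> real^'n^'k^'m \<Rightarrow> real^'n^'k^'m" where
  "Pstar P Q = (\<chi> i l j. Q $ i $ l $ j * P $ i $ j / marginal Q $ i $ j)"

definition Qstar_minus :: "real^'n^'k^'m \<Rightarrow> real^'k^'m" where
  "Qstar_minus A = (\<chi> i l. \<Sum>j\<in>UNIV. A $ i $ l $ j)"

text \<open>
  The second factor is a relation and not a function, because a row with vanishing denominator may
  be any probability vector. The choice does not affect \<open>Qstar\<close>: see \<open>factor_array_eq_Qstar\<close>.
\<close>

definition is_Qstar_plus :: "real^'n^'k^'m \<Rightarrow> real^'n^'k \<Rightarrow> bool" where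
  "is_Qstar_plus A H \<longleftrightarrow>
     (\<forall>l. let d = (\<Sum>i\<in>UNIV. \<Sum>j'\<in>UNIV. A $ i $ l $ j') in
        if d = 0 then (\<forall>j. 0 \<le> H $ l $ j) \<and> (\<Sum>j\<in>UNIV. H $ l $ j) = 1
        else (\<forall>j. H $ l $ j = (\<Sum>i\<in>UNIV. A $ i $ l $ j) / d))"

definition Qstar :: "real^'n^'k^'m \<Rightarrow> real^'n^'k^'m" where
  "Qstar A = (\<chi> i l j. Qstar_minus A $ i $ l *
     ((\<Sum>i'\<in>UNIV. A $ i' $ l $ j) / (\<Sum>i'\<in>UNIV. \<Sum>j'\<in>UNIV. A $ i' $ l $ j')))"

lemma factor_array_eq_Qstar:
  fixes A :: "real^'n^'k^'m"
  assumes nn: "\<And>i l j. 0 \<le> A $ i $ l $ j" and H: "is_Qstar_plus A H"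
  shows "factor_array (Qstar_minus A) H = Qstar A"
proof -
  have "Qstar_minus A $ i $ l * H $ l $ j = Qstar A $ i $ l $ j" for i l j
  proof (cases "(\<Sum>i'\<in>UNIV. \<Sum>j'\<in>UNIV. A $ i' $ l $ j') = 0")
    case True
    then have "(\<Sum>j'\<in>UNIV. A $ i $ l $ j') = 0"
      by (subst (asm) sum_nonneg_eq_0_iff) (auto intro: sum_nonneg nn)
    then show ?thesis by (simp add: Qstar_def Qstar_minus_def)
  next
    case False
    then show ?thesis using H by (simp add: Qstar_def is_Qstar_plus_def Let_def)
  qed
  then show ?thesis by (simp add: factor_array_def vec_eq_iff)
qed

lemma ex_Qstar_plus:
  fixes A :: "real^'n^'k^'m"
  assumes nn: "\<And>i l j. 0 \<le> A $ i $ l $ j"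
  obtains H where "is_Qstar_plus A H" "row_stochastic H"
proof -
  define d where "d l = (\<Sum>i\<in>UNIV. \<Sum>j\<in>UNIV. A $ i $ l $ j)" for l
  define H :: "real^'n^'k" where
    "H = (\<chi> l j. if d l = 0 then 1 / CARD('n) else (\<Sum>i\<in>UNIV. A $ i $ l $ j) / d l)"
  have d_nn: "0 \<le> d l" for l unfolding d_def by (intro sum_nonneg nn)
  have H_nn: "0 \<le> H $ l $ j" for l j
    using d_nn[of l] by (auto simp: H_def intro!: divide_nonneg_nonneg sum_nonneg nn)
  have H_sum: "(\<Sum>j\<in>UNIV. H $ l $ j) = 1" for l
  proof (cases "d l = 0")
    case True
    then show ?thesis by (simp add: H_def)
  next
    case False
    have "(\<Sum>j\<in>UNIV. \<Sum>i\<in>UNIV. A $ i $ l $ j) = d l"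
      unfolding d_def by (rule sum.swap)
    then show ?thesis using False by (simp add: H_def flip: sum_divide_distrib)
  qed
  have "is_Qstar_plus A H"
    unfolding is_Qstar_plus_def Let_def d_def[symmetric] using H_nn H_sum by (auto simp: H_def)
  moreover have "row_stochastic H" using H_nn H_sum by (simp add: row_stochastic_def)
  ultimately show thesis by (rule that)
qed

text \<open>
  The formulas above do solve the partial minimization problems. The side condition for \<open>Pstar\<close>
  cannot be dropped: without it \<open>P_set P\<close> contains no array with finite divergence from \<open>Q\<close>.
\<close>

lemma ln_tangent:
  fixes r s q :: real
  assumes "0 \<le> r" "0 < s" "0 < q"
  shows "idiv_term s q + ereal ((r - s) * ln (s / q)) \<le> idiv_term r q"
proof (cases "r = 0")
  case True
  then show ?thesis using assms by (simp add: idiv_term_def algebra_simps)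
next
  case False
  then have r: "0 < r" using assms by simp
  have "r * ln (s / r) \<le> r * (s / r - 1)"
    using r assms by (intro mult_left_mono ln_le_minus_one) auto
  also have "\<dots> = s - r" using r by (simp add: field_simps)
  finally have "r * ln s - r * ln r \<le> s - r"
    using r assms by (simp add: ln_div right_diff_distrib)
  then show ?thesis using r assms by (simp add: idiv_term_def ln_div algebra_simps)
qed

theorem Pstar_minimizer:
  fixes P :: "real^'n^'m" and Q :: "real^'n^'k^'m"
  assumes P: "\<And>i j. 0 \<le> P $ i $ j" and Q: "\<And>i l j. 0 \<le> Q $ i $ l $ j"
    and supp: "\<And>i j. marginal Q $ i $ j = 0 \<Longrightarrow> P $ i $ j = 0"
  shows "Pstar P Q \<in> P_set P"
    and "R \<in> P_set P \<Longrightarrow> Idiv3 (Pstar P Q) Q \<le> Idiv3 R Q"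
proof -
  let ?S = "Pstar P Q"
  have marg: "0 \<le> marginal Q $ i $ j" for i j
    by (simp add: marginal_def sum_nonneg Q)
  have S_nn: "0 \<le> ?S $ i $ l $ j" for i l j
    by (simp add: Pstar_def P Q marg)
  have S_sum: "(\<Sum>l\<in>UNIV. ?S $ i $ l $ j) = P $ i $ j" for i j
  proof -
    have "(\<Sum>l\<in>UNIV. ?S $ i $ l $ j) = marginal Q $ i $ j * P $ i $ j / marginal Q $ i $ j"
      by (simp add: Pstar_def marginal_def sum_distrib_right flip: sum_divide_distrib)
    then show ?thesis using supp[of i j] by auto
  qed
  show "?S \<in> P_set P" using S_nn S_sum by (simp add: P_set_def)
  assume "R \<in> P_set P"
  then have R_nn: "0 \<le> R $ i $ l $ j" and R_sum: "(\<Sum>l\<in>UNIV. R $ i $ l $ j) = P $ i $ j" for i l j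
    by (auto simp: P_set_def)
  define c where "c i j = ln (P $ i $ j / marginal Q $ i $ j)" for i j
  have le: "idiv_term (?S $ i $ l $ j) (Q $ i $ l $ j)
      + ereal ((R $ i $ l $ j - ?S $ i $ l $ j) * c i j)
      \<le> idiv_term (R $ i $ l $ j) (Q $ i $ l $ j)" for i l j
  proof (cases "?S $ i $ l $ j = 0")
    case True
    show ?thesis
    proof (cases "R $ i $ l $ j = 0")
      case True
      then show ?thesis using \<open>?S $ i $ l $ j = 0\<close> by simp
    next
      case False
      then have "0 < R $ i $ l $ j" using R_nn[of i l j] by simp
      also have "\<dots> \<le> (\<Sum>l\<in>UNIV. R $ i $ l $ j)" by (rule member_le_sum) (auto simp: R_nn)
      finally have "P $ i $ j \<noteq> 0" using R_sum[of i j] by simp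
      with supp[of i j] True have "Q $ i $ l $ j = 0" by (auto simp: Pstar_def)
      then show ?thesis using False by (simp add: idiv_term_def)
    qed
  next
    case False
    then have "0 < ?S $ i $ l $ j" "0 < Q $ i $ l $ j"
      using S_nn[of i l j] Q[of i l j] by (auto simp: Pstar_def order_less_le)
    moreover have "?S $ i $ l $ j / Q $ i $ l $ j = P $ i $ j / marginal Q $ i $ j"
      using \<open>0 < Q $ i $ l $ j\<close> by (simp add: Pstar_def)
    ultimately show ?thesis using ln_tangent[OF R_nn[of i l j]] unfolding c_def by metis
  qed
  have zero: "(\<Sum>(i, l, j)\<in>UNIV. (R $ i $ l $ j - ?S $ i $ l $ j) * c i j) = 0"
  proof -
    have "(\<Sum>(i, l, j)\<in>UNIV. (R $ i $ l $ j - ?S $ i $ l $ j) * c i j)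
        = (\<Sum>i\<in>UNIV. \<Sum>l\<in>UNIV. \<Sum>j\<in>UNIV. (R $ i $ l $ j - ?S $ i $ l $ j) * c i j)"
      by (simp add: sum.cartesian_product)
    also have "\<dots> = (\<Sum>i\<in>UNIV. \<Sum>j\<in>UNIV. \<Sum>l\<in>UNIV. (R $ i $ l $ j - ?S $ i $ l $ j) * c i j)"
      by (intro sum.cong refl sum.swap)
    also have "\<dots> = 0"
      by (simp add: R_sum S_sum sum_subtractf flip: sum_distrib_right)
    finally show ?thesis .
  qed
  have "Idiv3 ?S Q = Idiv3 ?S Q + ereal (\<Sum>(i, l, j)\<in>UNIV. (R $ i $ l $ j - ?S $ i $ l $ j) * c i j)"
    unfolding zero by simp
  also have "\<dots> = (\<Sum>(i, l, j)\<in>UNIV. idiv_term (?S $ i $ l $ j) (Q $ i $ l $ j)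
      + ereal ((R $ i $ l $ j - ?S $ i $ l $ j) * c i j))"
    unfolding Idiv3_def Idiv_def by (simp add: sum.distrib case_prod_unfold flip: sum_ereal)
  also have "\<dots> \<le> Idiv3 R Q"
    unfolding Idiv3_def Idiv_def by (intro sum_mono) (auto intro: le)
  finally show "Idiv3 ?S Q \<le> Idiv3 R Q" .
qed

lemma log_ratio:
  fixes a b :: real
  assumes "0 \<le> a" "0 \<le> b" "0 < a \<Longrightarrow> 0 < b"
  shows "a - b \<le> a * ln (a / b)"
proof (cases "a = 0")
  case True
  then show ?thesis using assms by simp
next
  case False
  then have a: "0 < a" "0 < b" using assms by auto
  have "a * ln (b / a) \<le> a * (b / a - 1)"
    using a by (intro mult_left_mono ln_le_minus_one) auto
  also have "\<dots> = b - a" using a by (simp add: field_simps)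
  finally show ?thesis using a by (simp add: ln_div algebra_simps)
qed

theorem Qstar_minimizer:
  fixes A :: "real^'n^'k^'m"
  assumes nn: "\<And>i l j. 0 \<le> A $ i $ l $ j"
  shows "Qstar A \<in> Q_set"
    and "Q \<in> Q_set \<Longrightarrow> Idiv3 A (Qstar A) \<le> Idiv3 A Q"
proof -
  obtain G where G: "is_Qstar_plus A G" and G_st: "row_stochastic G"
    using ex_Qstar_plus[OF nn] .
  define U where "U = Qstar_minus A"
  have star: "Qstar A = factor_array U G"
    using factor_array_eq_Qstar[OF nn G] by (simp add: U_def)
  have U_nn: "0 \<le> U $ i $ l" for i l by (simp add: U_def Qstar_minus_def sum_nonneg nn)
  have G_nn: "0 \<le> G $ l $ j" and G_sum: "(\<Sum>j\<in>UNIV. G $ l $ j) = 1" for l j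
    using G_st by (auto simp: row_stochastic_def)
  show "Qstar A \<in> Q_set" unfolding star Q_set_def using U_nn G_st by blast
  assume "Q \<in> Q_set"
  then obtain W H where Q: "Q = factor_array W H" and W_nn: "\<And>i l. 0 \<le> W $ i $ l"
    and H_st: "row_stochastic H" by (auto simp: Q_set_def)
  have H_nn: "0 \<le> H $ l $ j" and H_sum: "(\<Sum>j\<in>UNIV. H $ l $ j) = 1" for l j
    using H_st by (auto simp: row_stochastic_def)
  define d where "d l = (\<Sum>i\<in>UNIV. U $ i $ l)" for l
  have d_nn: "0 \<le> d l" for l by (simp add: d_def sum_nonneg U_nn)
  have A_j: "(\<Sum>j\<in>UNIV. A $ i $ l $ j) = U $ i $ l" for i l
    by (simp add: U_def Qstar_minus_def)
  have A_i: "(\<Sum>i\<in>UNIV. A $ i $ l $ j) = d l * G $ l $ j" for l j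
  proof (cases "d l = 0")
    case True
    then have z: "U $ i $ l = 0" for i
      unfolding d_def by (subst (asm) sum_nonneg_eq_0_iff) (auto simp: U_nn)
    have "A $ i $ l $ j = 0" for i
      using z[of i] unfolding A_j[symmetric] by (subst (asm) sum_nonneg_eq_0_iff) (auto simp: nn)
    then show ?thesis using True by simp
  next
    case False
    then show ?thesis using G
      by (auto simp: is_Qstar_plus_def Let_def d_def A_j)
  qed
  have A_U: "0 < U $ i $ l" if "0 < A $ i $ l $ j" for i l j
    using that member_le_sum[of j UNIV "\<lambda>j. A $ i $ l $ j"] nn A_j[of i l] by simp
  have A_G: "0 < d l * G $ l $ j" if "0 < A $ i $ l $ j" for i l j
    using that member_le_sum[of i UNIV "\<lambda>i. A $ i $ l $ j"] nn A_i[of l j] by simp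
  show "Idiv3 A (Qstar A) \<le> Idiv3 A Q"
  proof (cases "\<exists>i l j. 0 < A $ i $ l $ j \<and> Q $ i $ l $ j = 0")
    case True
    then obtain i l j where "0 < A $ i $ l $ j" "Q $ i $ l $ j = 0" by blast
    then have "idiv_term (A $ i $ l $ j) (Q $ i $ l $ j) = \<infinity>" by (simp add: idiv_term_def)
    then have "Idiv3 A Q = \<infinity>"
      unfolding Idiv3_def Idiv_def by (subst sum_Pinfty) (auto intro!: exI[of _ i] exI[of _ l] exI[of _ j])
    then show ?thesis by simp
  next
    case False
    have WH: "0 < W $ i $ l" "0 < H $ l $ j" if "0 < A $ i $ l $ j" for i l j
      using False that W_nn[of i l] H_nn[of l j] by (auto simp: Q factor_array_def order_less_le)
    define e where "e i l j = A $ i $ l $ j * ln (U $ i $ l / W $ i $ l)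
      + A $ i $ l $ j * ln (G $ l $ j / H $ l $ j) + W $ i $ l * H $ l $ j - U $ i $ l * G $ l $ j" for i l j
    have term_eq: "idiv_term (A $ i $ l $ j) (Q $ i $ l $ j)
        = idiv_term (A $ i $ l $ j) (Qstar A $ i $ l $ j) + ereal (e i l j)" for i l j
    proof (cases "A $ i $ l $ j = 0")
      case True
      then show ?thesis by (simp add: idiv_term_def e_def Q star factor_array_def)
    next
      case False
      then have a: "0 < A $ i $ l $ j" using nn[of i l j] by simp
      have g: "0 < G $ l $ j" using A_G[OF a] G_nn[of l j] by (auto simp: order_less_le)
      show ?thesis using a g A_U[OF a] WH[OF a]
        by (simp add: idiv_term_def e_def Q star factor_array_def ln_div ln_mult algebra_simps)
    qed
    have U_ge: "U $ i $ l - W $ i $ l \<le> U $ i $ l * ln (U $ i $ l / W $ i $ l)" for i l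
    proof (rule log_ratio[OF U_nn W_nn])
      assume "0 < U $ i $ l"
      then obtain j where "A $ i $ l $ j \<noteq> 0"
        unfolding A_j[symmetric] by (metis less_irrefl sum.neutral)
      then show "0 < W $ i $ l" using WH(1) nn[of i l j] by (auto simp: order_less_le)
    qed
    have G_ge: "d l * (G $ l $ j - H $ l $ j) \<le> d l * G $ l $ j * ln (G $ l $ j / H $ l $ j)" for l j
    proof (cases "d l = 0")
      case False
      have "G $ l $ j - H $ l $ j \<le> G $ l $ j * ln (G $ l $ j / H $ l $ j)"
      proof (rule log_ratio[OF G_nn H_nn])
        assume "0 < G $ l $ j"
        then have "0 < d l * G $ l $ j" using False d_nn[of l] by (simp add: order_less_le)
        then obtain i where "A $ i $ l $ j \<noteq> 0"
          unfolding A_i[symmetric] by (metis less_irrefl sum.neutral)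
        then show "0 < H $ l $ j" using WH(2) nn[of i l j] by (auto simp: order_less_le)
      qed
      then show ?thesis using d_nn[of l] by (simp add: mult_left_mono mult.assoc)
    qed simp
    have s1: "(\<Sum>i\<in>UNIV. \<Sum>l\<in>UNIV. \<Sum>j\<in>UNIV. A $ i $ l $ j * ln (U $ i $ l / W $ i $ l))
        = (\<Sum>i\<in>UNIV. \<Sum>l\<in>UNIV. U $ i $ l * ln (U $ i $ l / W $ i $ l))"
      by (simp add: A_j flip: sum_distrib_right)
    have s2: "(\<Sum>i\<in>UNIV. \<Sum>l\<in>UNIV. \<Sum>j\<in>UNIV. A $ i $ l $ j * ln (G $ l $ j / H $ l $ j))
        = (\<Sum>l\<in>UNIV. \<Sum>j\<in>UNIV. d l * G $ l $ j * ln (G $ l $ j / H $ l $ j))"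
    proof -
      have "(\<Sum>i\<in>UNIV. \<Sum>l\<in>UNIV. \<Sum>j\<in>UNIV. A $ i $ l $ j * ln (G $ l $ j / H $ l $ j))
          = (\<Sum>l\<in>UNIV. \<Sum>i\<in>UNIV. \<Sum>j\<in>UNIV. A $ i $ l $ j * ln (G $ l $ j / H $ l $ j))"
        by (rule sum.swap)
      also have "\<dots> = (\<Sum>l\<in>UNIV. \<Sum>j\<in>UNIV. \<Sum>i\<in>UNIV. A $ i $ l $ j * ln (G $ l $ j / H $ l $ j))"
        by (intro sum.cong refl sum.swap)
      finally show ?thesis by (simp add: A_i flip: sum_distrib_right)
    qed
    have s3: "(\<Sum>i\<in>UNIV. \<Sum>l\<in>UNIV. \<Sum>j\<in>UNIV. W $ i $ l * H $ l $ j)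
        = (\<Sum>i\<in>UNIV. \<Sum>l\<in>UNIV. W $ i $ l)"
      by (simp add: H_sum flip: sum_distrib_left)
    have s4: "(\<Sum>i\<in>UNIV. \<Sum>l\<in>UNIV. \<Sum>j\<in>UNIV. U $ i $ l * G $ l $ j)
        = (\<Sum>i\<in>UNIV. \<Sum>l\<in>UNIV. U $ i $ l)"
      by (simp add: G_sum flip: sum_distrib_left)
    have "(\<Sum>i\<in>UNIV. \<Sum>l\<in>UNIV. U $ i $ l - W $ i $ l)
        \<le> (\<Sum>i\<in>UNIV. \<Sum>l\<in>UNIV. U $ i $ l * ln (U $ i $ l / W $ i $ l))"
      by (intro sum_mono U_ge)
    moreover have "(\<Sum>l\<in>UNIV. \<Sum>j\<in>UNIV. d l * (G $ l $ j - H $ l $ j))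
        \<le> (\<Sum>l\<in>UNIV. \<Sum>j\<in>UNIV. d l * G $ l $ j * ln (G $ l $ j / H $ l $ j))"
      by (intro sum_mono G_ge)
    moreover have "(\<Sum>l\<in>UNIV. \<Sum>j\<in>UNIV. d l * (G $ l $ j - H $ l $ j)) = 0"
      by (simp add: G_sum H_sum sum_subtractf flip: sum_distrib_left)
    ultimately have e_nn: "0 \<le> (\<Sum>i\<in>UNIV. \<Sum>l\<in>UNIV. \<Sum>j\<in>UNIV. e i l j)"
      unfolding e_def sum.distrib sum_subtractf s1 s2 s3 s4 by simp
    have "Idiv3 A Q = (\<Sum>(i, l, j)\<in>UNIV. idiv_term (A $ i $ l $ j) (Qstar A $ i $ l $ j) + ereal (e i l j))"
      unfolding Idiv3_def Idiv_def by (simp add: term_eq case_prod_unfold)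
    also have "\<dots> = Idiv3 A (Qstar A) + ereal (\<Sum>(i, l, j)\<in>UNIV. e i l j)"
      unfolding Idiv3_def Idiv_def by (simp add: sum.distrib case_prod_unfold flip: sum_ereal)
    also have "(\<Sum>(i, l, j)\<in>UNIV. e i l j) = (\<Sum>i\<in>UNIV. \<Sum>l\<in>UNIV. \<Sum>j\<in>UNIV. e i l j)"
      by (simp add: sum.cartesian_product)
    finally have eq: "Idiv3 A Q = Idiv3 A (Qstar A) + ereal (\<Sum>i\<in>UNIV. \<Sum>l\<in>UNIV. \<Sum>j\<in>UNIV. e i l j)" .
    show ?thesis unfolding eq using e_nn
      by (metis add.right_neutral add_left_mono ereal_less_eq(3) zero_ereal_def)
  qed
qed

end

theory Submission
  imports Defs
begin

text \<open>
  The identity in the theorem is the sum of two Pythagorean identities for the I-divergence, one for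
  each partial minimization.

  On the cells where it does not vanish, the ratio \<open>Pstar P Q / Q\<close> is \<open>P / marginal Q\<close>, which does
  not depend on the middle index. Hence \<open>\<Sum> R ln (Pstar P Q / Q)\<close> has the same value for all nonnegative
  \<open>R\<close> with marginal \<open>P\<close> that vanish where \<open>Q\<close> does, and this value accounts for the divergence of the marginals
  (\<open>Idiv3_Pstar_pythagoras\<close>). The choice \<open>R = Pstar P Q\<close> shows that the minimum over \<open>P_set P\<close>
  equals the divergence of the marginals (\<open>Idiv3_Pstar_eq_Idiv2\<close>).

  When \<open>Q\<close> factors as \<open>W H\<close>, the logarithm of the ratio \<open>Qstar A / Q\<close> is a sum of a function of
  \<open>(i, l)\<close> and a function of \<open>(l, j)\<close>. The arrays \<open>A\<close> and \<open>Qstar A\<close> have the same \<open>(i, l)\<close> and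
  \<open>(l, j)\<close> marginals, so \<open>ln (Qstar A / Q)\<close> has the same sum against \<open>A\<close> as against \<open>Qstar A\<close>
  (\<open>Idiv3_Qstar_pythagoras\<close>).

  Starting from \<open>Idiv2 V (W t ** H t) = Idiv3 (PP t) (QQ t)\<close>, the second identity splits off
  \<open>Idiv3 (QQ (t + 1)) (QQ t)\<close> and the first one splits the remainder \<open>Idiv3 (PP t) (QQ (t + 1))\<close>.
  All this needs the logarithms to be finite: wherever \<open>V\<close> is positive, the marginal of \<open>QQ t\<close> must
  be positive. This holds for \<open>QQ 1\<close> by positivity. It propagates because \<open>Pstar V\<close> only removes
  entries over the zeros of \<open>V\<close> and \<open>Qstar\<close> removes none (\<open>marginal_Qstar_Pstar_supp\<close>).
  Monotonicity then follows from nonnegativity of the divergence.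
\<close>

section \<open>Elementary properties of the divergence\<close>

lemma Idiv2_eq_sum:
  "Idiv2 M N = (\<Sum>i\<in>UNIV. \<Sum>j\<in>UNIV. idiv_term (M $ i $ j) (N $ i $ j))"
  by (simp add: Idiv2_def Idiv_def sum.cartesian_product case_prod_unfold)

lemma Idiv3_eq_sum:
  "Idiv3 M N = (\<Sum>i\<in>UNIV. \<Sum>l\<in>UNIV. \<Sum>j\<in>UNIV. idiv_term (M $ i $ l $ j) (N $ i $ l $ j))"
  by (simp add: Idiv3_def Idiv_def sum.cartesian_product case_prod_unfold)

lemma Idiv3_self: "Idiv3 M M = 0"
proof -
  have "idiv_term p p = 0" for p
    by (simp add: idiv_term_def zero_ereal_def)
  then show ?thesis by (simp add: Idiv3_eq_sum)
qed

text \<open>The tangent to \<open>idiv_term _ q\<close> at \<open>q\<close> is the zero function.\<close>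

lemma idiv_term_nonneg:
  assumes "0 \<le> p" "0 \<le> q"
  shows "0 \<le> idiv_term p q"
proof (cases "q = 0")
  case True
  then show ?thesis by (simp add: idiv_term_def)
next
  case False
  then show ?thesis using ln_tangent[of p q q] assms by (simp add: idiv_term_def zero_ereal_def)
qed

lemma Idiv3_nonneg:
  assumes "\<And>i l j. 0 \<le> M $ i $ l $ j" "\<And>i l j. 0 \<le> N $ i $ l $ j"
  shows "0 \<le> Idiv3 M N"
  unfolding Idiv3_eq_sum by (intro sum_nonneg idiv_term_nonneg assms)

section \<open>The Pythagorean identity for arrays with a given marginal\<close>

lemma Pstar_nonneg:
  assumes "\<And>i j. 0 \<le> P $ i $ j" "\<And>i l j. 0 \<le> Q $ i $ l $ j"
  shows "0 \<le> Pstar P Q $ i $ l $ j"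
  using assms by (simp add: Pstar_def marginal_def sum_nonneg)

lemma Idiv3_Pstar_pythagoras:
  fixes P :: "real^'n^'m" and Q R :: "real^'n^'k^'m"
  assumes P: "\<And>i j. 0 \<le> P $ i $ j" and Q: "\<And>i l j. 0 \<le> Q $ i $ l $ j"
    and supp: "\<And>i j. marginal Q $ i $ j = 0 \<Longrightarrow> P $ i $ j = 0"
    and R: "R \<in> P_set P"
  shows "Idiv3 R Q = Idiv3 R (Pstar P Q) + Idiv2 P (marginal Q)"
proof -
  let ?S = "Pstar P Q" and ?M = "marginal Q"
  have R_nn: "0 \<le> R $ i $ l $ j" and R_sum: "(\<Sum>l\<in>UNIV. R $ i $ l $ j) = P $ i $ j" for i l j
    using R by (auto simp: P_set_def)
  have S_sum: "(\<Sum>l\<in>UNIV. ?S $ i $ l $ j) = P $ i $ j" for i j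
    using Pstar_minimizer(1)[OF P Q supp] by (simp add: P_set_def)
  have Q_sum: "(\<Sum>l\<in>UNIV. Q $ i $ l $ j) = ?M $ i $ j" for i j
    by (simp add: marginal_def)
  have M_nn: "0 \<le> ?M $ i $ j" for i j
    by (simp add: marginal_def sum_nonneg Q)
  have RP: "0 < P $ i $ j" if "R $ i $ l $ j \<noteq> 0" for i l j
  proof -
    have "0 < R $ i $ l $ j" using that R_nn[of i l j] by simp
    then have "0 < (\<Sum>l\<in>UNIV. R $ i $ l $ j)" by (auto intro: sum_pos2 R_nn)
    then show ?thesis by (simp only: R_sum)
  qed
  define e where
    "e i l j = R $ i $ l $ j * ln (P $ i $ j / ?M $ i $ j) - ?S $ i $ l $ j + Q $ i $ l $ j" for i l j
  \<comment> \<open>Where \<open>Q\<close> vanishes but \<open>R\<close> does not, both sides are infinite.\<close>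
  have term_eq: "idiv_term (R $ i $ l $ j) (Q $ i $ l $ j)
      = idiv_term (R $ i $ l $ j) (?S $ i $ l $ j) + ereal (e i l j)" for i l j
  proof (cases "R $ i $ l $ j = 0")
    case True
    then show ?thesis by (simp add: idiv_term_def e_def)
  next
    case False
    then have r: "0 < R $ i $ l $ j" using R_nn[of i l j] by simp
    have p: "0 < P $ i $ j" by (rule RP[OF False])
    then have m: "0 < ?M $ i $ j" using supp[of i j] M_nn[of i j] by (auto simp: order_less_le)
    show ?thesis
    proof (cases "Q $ i $ l $ j = 0")
      case True
      then show ?thesis using False by (simp add: idiv_term_def Pstar_def)
    next
      case False
      then have q: "0 < Q $ i $ l $ j" using Q[of i l j] by simp
      have "?S $ i $ l $ j = Q $ i $ l $ j * P $ i $ j / ?M $ i $ j" by (simp add: Pstar_def)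
      moreover from this have "0 < ?S $ i $ l $ j" using p m q by simp
      ultimately show ?thesis using r p m q
        by (simp add: idiv_term_def e_def ln_div ln_mult algebra_simps)
    qed
  qed
  have e_sum: "(\<Sum>l\<in>UNIV. ereal (e i l j)) = idiv_term (P $ i $ j) (?M $ i $ j)" for i j
  proof -
    have "(\<Sum>l\<in>UNIV. e i l j) = P $ i $ j * ln (P $ i $ j / ?M $ i $ j) - P $ i $ j + ?M $ i $ j"
      by (simp add: e_def sum.distrib sum_subtractf R_sum S_sum Q_sum flip: sum_distrib_right)
    then show ?thesis using supp[of i j] by (auto simp: idiv_term_def)
  qed
  have "Idiv3 R Q = Idiv3 R ?S + (\<Sum>i\<in>UNIV. \<Sum>l\<in>UNIV. \<Sum>j\<in>UNIV. ereal (e i l j))"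
    unfolding Idiv3_eq_sum by (simp add: term_eq sum.distrib del: sum_ereal)
  also have "(\<Sum>i\<in>UNIV. \<Sum>l\<in>UNIV. \<Sum>j\<in>UNIV. ereal (e i l j))
      = (\<Sum>i\<in>UNIV. \<Sum>j\<in>UNIV. \<Sum>l\<in>UNIV. ereal (e i l j))"
    by (intro sum.cong refl sum.swap)
  also have "\<dots> = Idiv2 P ?M"
    unfolding e_sum Idiv2_eq_sum ..
  finally show ?thesis .
qed

corollary Idiv3_Pstar_eq_Idiv2:
  fixes P :: "real^'n^'m" and Q :: "real^'n^'k^'m"
  assumes "\<And>i j. 0 \<le> P $ i $ j" "\<And>i l j. 0 \<le> Q $ i $ l $ j"
    and "\<And>i j. marginal Q $ i $ j = 0 \<Longrightarrow> P $ i $ j = 0"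
  shows "Idiv3 (Pstar P Q) Q = Idiv2 P (marginal Q)"
  using Idiv3_Pstar_pythagoras[OF assms Pstar_minimizer(1)[OF assms]] by (simp add: Idiv3_self)

section \<open>The Pythagorean identity for factored arrays\<close>

lemma Qstar_nonneg:
  assumes "\<And>i l j. 0 \<le> A $ i $ l $ j"
  shows "0 \<le> Qstar A $ i $ l $ j"
  using assms
  by (auto simp: Qstar_def Qstar_minus_def intro!: mult_nonneg_nonneg divide_nonneg_nonneg sum_nonneg)

lemma sum_middle_last_Qstar:
  assumes nn: "\<And>i l j. 0 \<le> A $ i $ l $ j"
  shows "(\<Sum>j\<in>UNIV. Qstar A $ i $ l $ j) = (\<Sum>j\<in>UNIV. A $ i $ l $ j)"
proof -
  obtain G where G: "is_Qstar_plus A G" "row_stochastic G"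
    using ex_Qstar_plus[OF nn] .
  have "Qstar A $ i $ l $ j = Qstar_minus A $ i $ l * G $ l $ j" for j
    unfolding factor_array_eq_Qstar[OF nn G(1), symmetric] by (simp add: factor_array_def)
  then show ?thesis
    using G(2) by (simp add: row_stochastic_def Qstar_minus_def flip: sum_distrib_left)
qed

lemma sum_first_Qstar:
  assumes nn: "\<And>i l j. 0 \<le> A $ i $ l $ j"
  shows "(\<Sum>i\<in>UNIV. Qstar A $ i $ l $ j) = (\<Sum>i\<in>UNIV. A $ i $ l $ j)"
proof (cases "(\<Sum>i\<in>UNIV. \<Sum>j\<in>UNIV. A $ i $ l $ j) = 0")
  case True
  then have "A $ i $ l $ j = 0" for i
    by (simp add: sum_nonneg_eq_0_iff sum_nonneg nn)
  then show ?thesis by (simp add: Qstar_def)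
next
  case False
  then show ?thesis by (simp add: Qstar_def Qstar_minus_def flip: sum_distrib_right sum_divide_distrib)
qed

lemma Qstar_pos:
  assumes nn: "\<And>i l j. 0 \<le> A $ i $ l $ j" and pos: "0 < A $ i $ l $ j"
  shows "0 < Qstar A $ i $ l $ j"
proof -
  have 1: "0 < (\<Sum>j\<in>UNIV. A $ i $ l $ j)" and 2: "0 < (\<Sum>i\<in>UNIV. A $ i $ l $ j)"
    using pos nn by (auto intro: sum_pos2)
  have "0 < (\<Sum>i\<in>UNIV. \<Sum>j\<in>UNIV. A $ i $ l $ j)"
    using 1 nn by (auto intro!: sum_pos2[of _ i] sum_nonneg)
  with 1 2 show ?thesis by (simp add: Qstar_def Qstar_minus_def)
qed

text \<open>
  A nonzero entry of \<open>Qstar A\<close> comes from two nonzero entries of \<open>A\<close>, one in the fibre \<open>(i, l, _)\<close>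
  and one in the fibre \<open>(_, l, j)\<close>. Therefore any factored array that is positive on the support
  of \<open>A\<close> is positive on the support of \<open>Qstar A\<close> too.
\<close>

lemma Qstar_support:
  assumes "Qstar A $ i $ l $ j \<noteq> 0"
  obtains i' j' where "A $ i $ l $ j' \<noteq> 0" "A $ i' $ l $ j \<noteq> 0"
proof -
  have "(\<Sum>j\<in>UNIV. A $ i $ l $ j) \<noteq> 0" "(\<Sum>i\<in>UNIV. A $ i $ l $ j) \<noteq> 0"
    using assms by (auto simp: Qstar_def Qstar_minus_def)
  then show thesis using that by (metis sum.neutral)
qed

lemma Idiv3_Qstar_pythagoras:
  fixes A :: "real^'n^'k^'m" and W :: "real^'k^'m" and H :: "real^'n^'k"
  assumes nn: "\<And>i l j. 0 \<le> A $ i $ l $ j"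
    and W: "\<And>i l. 0 \<le> W $ i $ l" and H: "\<And>l j. 0 \<le> H $ l $ j"
    and supp: "\<And>i l j. factor_array W H $ i $ l $ j = 0 \<Longrightarrow> A $ i $ l $ j = 0"
  shows "Idiv3 A (factor_array W H)
    = Idiv3 A (Qstar A) + Idiv3 (Qstar A) (factor_array W H)"
proof -
  let ?S = "Qstar A"
  define u where "u i l = ln (Qstar_minus A $ i $ l / W $ i $ l)" for i l
  define v where "v l j = ln ((\<Sum>i\<in>UNIV. A $ i $ l $ j)
      / (\<Sum>i\<in>UNIV. \<Sum>j'\<in>UNIV. A $ i $ l $ j') / H $ l $ j)" for l j
  \<comment> \<open>The summand of \<open>\<Sum> (A - Qstar A) ln (Qstar A / Q)\<close>, with the logarithm split into its two parts.\<close>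
  define e where "e i l j = (A $ i $ l $ j - ?S $ i $ l $ j) * u i l
      + (A $ i $ l $ j - ?S $ i $ l $ j) * v l j" for i l j
  have term_eq: "idiv_term (A $ i $ l $ j) (factor_array W H $ i $ l $ j)
      = idiv_term (A $ i $ l $ j) (?S $ i $ l $ j)
      + idiv_term (?S $ i $ l $ j) (factor_array W H $ i $ l $ j) + ereal (e i l j)" for i l j
  proof (cases "?S $ i $ l $ j = 0")
    case True
    then have "A $ i $ l $ j = 0" using Qstar_pos[OF nn] nn[of i l j] by (auto simp: order_less_le)
    with True show ?thesis by (simp add: idiv_term_def e_def)
  next
    case False
    obtain i' j' where "A $ i $ l $ j' \<noteq> 0" "A $ i' $ l $ j \<noteq> 0"
      using Qstar_support[OF False] .
    then have "W $ i $ l \<noteq> 0" "H $ l $ j \<noteq> 0"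
      using supp[of i l j'] supp[of i' l j] by (auto simp: factor_array_def)
    then have w: "0 < W $ i $ l" and h: "0 < H $ l $ j"
      using W[of i l] H[of l j] by (simp_all add: order_less_le)
    define x where "x = Qstar_minus A $ i $ l"
    define y where "y = (\<Sum>i\<in>UNIV. A $ i $ l $ j) / (\<Sum>i\<in>UNIV. \<Sum>j'\<in>UNIV. A $ i $ l $ j')"
    have S_eq: "?S $ i $ l $ j = x * y" by (simp add: Qstar_def x_def y_def)
    have "0 \<le> x" "0 \<le> y"
      by (auto simp: x_def y_def Qstar_minus_def intro!: divide_nonneg_nonneg sum_nonneg nn)
    with False S_eq have xy: "0 < x" "0 < y" by (auto simp: order_less_le)
    have e_eq: "e i l j = (A $ i $ l $ j - x * y) * (ln (x / W $ i $ l) + ln (y / H $ l $ j))"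
      by (simp add: e_def u_def v_def S_eq x_def[symmetric] y_def[symmetric] distrib_left)
    show ?thesis
      using xy w h nn[of i l j] unfolding S_eq e_eq
      by (auto simp: idiv_term_def factor_array_def ln_div ln_mult algebra_simps)
  qed
  have s1: "(\<Sum>i\<in>UNIV. \<Sum>l\<in>UNIV. \<Sum>j\<in>UNIV. (A $ i $ l $ j - ?S $ i $ l $ j) * u i l) = 0"
    by (simp add: sum_subtractf sum_middle_last_Qstar[OF nn] flip: sum_distrib_right)
  have "(\<Sum>i\<in>UNIV. \<Sum>l\<in>UNIV. \<Sum>j\<in>UNIV. (A $ i $ l $ j - ?S $ i $ l $ j) * v l j)
      = (\<Sum>l\<in>UNIV. \<Sum>i\<in>UNIV. \<Sum>j\<in>UNIV. (A $ i $ l $ j - ?S $ i $ l $ j) * v l j)"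
    by (rule sum.swap)
  also have "\<dots> = (\<Sum>l\<in>UNIV. \<Sum>j\<in>UNIV. \<Sum>i\<in>UNIV. (A $ i $ l $ j - ?S $ i $ l $ j) * v l j)"
    by (intro sum.cong refl sum.swap)
  also have "\<dots> = 0"
    by (simp add: sum_subtractf sum_first_Qstar[OF nn] flip: sum_distrib_right)
  finally have "(\<Sum>i\<in>UNIV. \<Sum>l\<in>UNIV. \<Sum>j\<in>UNIV. e i l j) = 0"
    unfolding e_def sum.distrib s1 by simp
  then show ?thesis
    unfolding Idiv3_eq_sum by (simp add: term_eq sum.distrib)
qed

section \<open>One step of the alternating minimization\<close>

lemma matrix_mult_eq_marginal: "W ** H = marginal (factor_array W H)"
  by (simp add: matrix_matrix_mult_def marginal_def factor_array_def)

lemma is_Qstar_plus_nonneg: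
  assumes "\<And>i l j. 0 \<le> A $ i $ l $ j" "is_Qstar_plus A H"
  shows "0 \<le> H $ l $ j"
proof (cases "(\<Sum>i\<in>UNIV. \<Sum>j'\<in>UNIV. A $ i $ l $ j') = 0")
  case True
  then show ?thesis using assms(2) by (simp add: is_Qstar_plus_def Let_def)
next
  case False
  then show ?thesis using assms
    by (auto simp: is_Qstar_plus_def Let_def intro!: divide_nonneg_nonneg sum_nonneg)
qed

text \<open>
  If \<open>P\<close> is positive at \<open>(i, j)\<close>, then so is some \<open>Pstar P Q $ i $ l $ j\<close>, because these entries sum
  to \<open>P $ i $ j\<close>; and \<open>Qstar\<close> keeps that entry positive. So the support condition that makes both
  identities applicable passes to the next iterate.
\<close>

lemma marginal_Qstar_Pstar_supp:
  fixes P :: "real^'n^'m" and Q :: "real^'n^'k^'m"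
  assumes P: "\<And>i j. 0 \<le> P $ i $ j" and Q: "\<And>i l j. 0 \<le> Q $ i $ l $ j"
    and supp: "\<And>i j. marginal Q $ i $ j = 0 \<Longrightarrow> P $ i $ j = 0"
    and zero: "marginal (Qstar (Pstar P Q)) $ i $ j = 0"
  shows "P $ i $ j = 0"
proof -
  have nn: "0 \<le> Pstar P Q $ i $ l $ j" for i l j by (rule Pstar_nonneg[OF P Q])
  have "Qstar (Pstar P Q) $ i $ l $ j = 0" for l
    using zero by (simp add: marginal_def sum_nonneg_eq_0_iff Qstar_nonneg[OF nn])
  then have "Pstar P Q $ i $ l $ j = 0" for l
    using Qstar_pos[OF nn, of i l j] nn[of i l j] by (metis less_irrefl order_less_le)
  then show ?thesis
  proof -
    have "P $ i $ j = (\<Sum>l\<in>UNIV. Pstar P Q $ i $ l $ j)"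
      using Pstar_minimizer(1)[OF P Q supp] by (simp add: P_set_def)
    then show ?thesis by (simp add: \<open>\<And>l. Pstar P Q $ i $ l $ j = 0\<close>)
  qed
qed

lemma Idiv2_alternating_step:
  fixes P :: "real^'n^'m" and W :: "real^'k^'m" and H :: "real^'n^'k"
  defines "Q \<equiv> factor_array W H"
  defines "Q' \<equiv> Qstar (Pstar P Q)"
  assumes P: "\<And>i j. 0 \<le> P $ i $ j"
    and W: "\<And>i l. 0 \<le> W $ i $ l" and H: "\<And>l j. 0 \<le> H $ l $ j"
    and supp: "\<And>i j. marginal Q $ i $ j = 0 \<Longrightarrow> P $ i $ j = 0"
  shows "Idiv2 P (marginal Q)
    = Idiv3 (Pstar P Q) (Pstar P Q') + Idiv2 P (marginal Q') + Idiv3 Q' Q"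
proof -
  have Q: "0 \<le> Q $ i $ l $ j" for i l j by (simp add: Q_def factor_array_def W H)
  have nn: "0 \<le> Pstar P Q $ i $ l $ j" for i l j by (rule Pstar_nonneg[OF P Q])
  have Q': "0 \<le> Q' $ i $ l $ j" for i l j unfolding Q'_def by (rule Qstar_nonneg[OF nn])
  have supp': "P $ i $ j = 0" if "marginal Q' $ i $ j = 0" for i j
    by (rule marginal_Qstar_Pstar_supp[OF P Q supp that[unfolded Q'_def]])
  have "Idiv2 P (marginal Q) = Idiv3 (Pstar P Q) Q"
    by (rule Idiv3_Pstar_eq_Idiv2[OF P Q supp, symmetric])
  also have "\<dots> = Idiv3 (Pstar P Q) Q' + Idiv3 Q' Q"
    using Idiv3_Qstar_pythagoras[OF nn W H] unfolding Q'_def Q_def by (simp add: Pstar_def)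
  also have "Idiv3 (Pstar P Q) Q' = Idiv3 (Pstar P Q) (Pstar P Q') + Idiv2 P (marginal Q')"
    by (rule Idiv3_Pstar_pythagoras[OF P Q' supp' Pstar_minimizer(1)[OF P Q supp]])
  finally show ?thesis .
qed

section \<open>The multiplicative update rules and monotonicity\<close>

theorem mainTheorem2:
  fixes V :: "real^'n^'m"
    and W :: "nat \<Rightarrow> real^'k^'m" and H :: "nat \<Rightarrow> real^'n^'k"
    and PP QQ :: "nat \<Rightarrow> real^'n^'k^'m"
  assumes dims: "CARD('k) \<le> min CARD('m) CARD('n)"
    and V_nonneg: "\<And>i j. 0 \<le> V $ i $ j"
    and Q1_mem: "QQ 1 \<in> Q_set"
    and Q1_pos: "\<And>i l j. 0 < QQ 1 $ i $ l $ j"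
    and Q1_factors: "QQ 1 = factor_array (W 1) (H 1)" "row_stochastic (H 1)"
    and P_step: "\<And>t. 1 \<le> t \<Longrightarrow> PP t = Pstar V (QQ t)"
    and Q_step: "\<And>t. 1 \<le> t \<Longrightarrow> QQ (t + 1) = Qstar (PP t)"
    and W_step: "\<And>t. 1 \<le> t \<Longrightarrow> W (t + 1) = Qstar_minus (PP t)"
    and H_step: "\<And>t. 1 \<le> t \<Longrightarrow> is_Qstar_plus (PP t) (H (t + 1))"
  shows "\<forall>t\<ge>1.
      (\<forall>i l. W (t + 1) $ i $ l =
         (\<Sum>j\<in>UNIV. V $ i $ j * (W t $ i $ l * H t $ l $ j / (W t ** H t) $ i $ j)))
    \<and> (\<forall>l j.
         0 < (\<Sum>i\<in>UNIV. \<Sum>j'\<in>UNIV. V $ i $ j' * (W t $ i $ l * H t $ l $ j') / (W t ** H t) $ i $ j')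
         \<longrightarrow> H (t + 1) $ l $ j =
           (\<Sum>i\<in>UNIV. V $ i $ j * (W t $ i $ l * H t $ l $ j) / (W t ** H t) $ i $ j) /
           (\<Sum>i\<in>UNIV. \<Sum>j'\<in>UNIV. V $ i $ j' * (W t $ i $ l * H t $ l $ j') / (W t ** H t) $ i $ j'))
    \<and> Idiv2 V (W t ** H t) =
         Idiv3 (PP t) (PP (t + 1)) + Idiv2 V (W (t + 1) ** H (t + 1)) + Idiv3 (QQ (t + 1)) (QQ t)
    \<and> Idiv2 V (W (t + 1) ** H (t + 1)) \<le> Idiv2 V (W t ** H t)"
proof (intro allI impI)
  fix t :: nat
  assume t: "1 \<le> t"
  have inv: "QQ s = factor_array (W s) (H s) \<and> (\<forall>i l. 0 \<le> W s $ i $ l) \<and> (\<forall>l j. 0 \<le> H s $ l $ j)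
      \<and> (\<forall>i j. marginal (QQ s) $ i $ j = 0 \<longrightarrow> V $ i $ j = 0)" if "1 \<le> s" for s
    using that
  proof (induction s rule: dec_induct)
    case base
    have H1: "0 \<le> H 1 $ l $ j" for l j
      using Q1_factors(2) by (simp add: row_stochastic_def)
    have W1: "0 \<le> W 1 $ i $ l" for i l
    proof -
      \<comment> \<open>Any column would do.\<close>
      have "0 < W 1 $ i $ l * H 1 $ l $ undefined"
        using Q1_pos[of i l undefined] unfolding Q1_factors(1) by (simp add: factor_array_def)
      then show ?thesis
        using H1[of l undefined] unfolding zero_less_mult_iff by auto
    qed
    have "0 < marginal (QQ 1) $ i $ j" for i j
      using Q1_pos by (auto simp: marginal_def simp del: One_nat_def intro: sum_pos)
    then have "marginal (QQ 1) $ i $ j \<noteq> 0" for i j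
      by (rule less_imp_neq[THEN not_sym])
    with W1 H1 Q1_factors(1) show ?case by blast
  next
    case (step s)
    have s: "1 \<le> s" by fact
    have Q: "0 \<le> QQ s $ i $ l $ j" for i l j
      using step.IH by (simp add: factor_array_def)
    have nn: "0 \<le> PP s $ i $ l $ j" for i l j
      unfolding P_step[OF s] by (rule Pstar_nonneg[OF V_nonneg Q])
    have "QQ (s + 1) = factor_array (W (s + 1)) (H (s + 1))"
      using factor_array_eq_Qstar[OF nn H_step[OF s]] by (simp only: Q_step[OF s] W_step[OF s])
    moreover have "0 \<le> W (s + 1) $ i $ l" for i l
      unfolding W_step[OF s] by (simp add: Qstar_minus_def sum_nonneg nn)
    moreover have "0 \<le> H (s + 1) $ l $ j" for l j
      by (rule is_Qstar_plus_nonneg[OF nn H_step[OF s]])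
    moreover have "V $ i $ j = 0" if "marginal (QQ (s + 1)) $ i $ j = 0" for i j
      using marginal_Qstar_Pstar_supp[OF V_nonneg Q, of i j] step.IH that
      unfolding Q_step[OF s] P_step[OF s] by blast
    ultimately show ?case by simp
  qed
  have t': "1 \<le> t + 1" by simp
  have Qt: "QQ t = factor_array (W t) (H t)" and Wt: "\<And>i l. 0 \<le> W t $ i $ l"
    and Ht: "\<And>l j. 0 \<le> H t $ l $ j"
    and supp: "\<And>i j. marginal (factor_array (W t) (H t)) $ i $ j = 0 \<Longrightarrow> V $ i $ j = 0"
    using inv[OF t] by auto
  have Qt': "QQ (t + 1) = factor_array (W (t + 1)) (H (t + 1))"
    using inv[OF t'] by blast
  have nnQ: "0 \<le> QQ s $ i $ l $ j" if "1 \<le> s" for s i l j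
    using inv[OF that] by (simp add: factor_array_def)
  have nnP: "0 \<le> PP s $ i $ l $ j" if "1 \<le> s" for s i l j
    unfolding P_step[OF that] by (rule Pstar_nonneg[OF V_nonneg nnQ[OF that]])
  have mt: "W t ** H t = marginal (QQ t)" and mt': "W (t + 1) ** H (t + 1) = marginal (QQ (t + 1))"
    unfolding Qt Qt' by (rule matrix_mult_eq_marginal)+
  have PPt: "PP t $ i $ l $ j = V $ i $ j * (W t $ i $ l * H t $ l $ j) / (W t ** H t) $ i $ j" for i l j
    unfolding P_step[OF t] mt by (simp add: Pstar_def Qt factor_array_def mult.commute)
  have "W (t + 1) $ i $ l = (\<Sum>j\<in>UNIV. V $ i $ j * (W t $ i $ l * H t $ l $ j / (W t ** H t) $ i $ j))"
    for i l
    unfolding W_step[OF t] Qstar_minus_def by (simp add: PPt)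
  moreover have "H (t + 1) $ l $ j = (\<Sum>i\<in>UNIV. PP t $ i $ l $ j) / (\<Sum>i\<in>UNIV. \<Sum>j'\<in>UNIV. PP t $ i $ l $ j')"
    if "0 < (\<Sum>i\<in>UNIV. \<Sum>j'\<in>UNIV. PP t $ i $ l $ j')" for l j
    using H_step[OF t] that unfolding is_Qstar_plus_def Let_def
    by (metis less_irrefl)
  moreover have D: "Idiv2 V (W t ** H t) = Idiv3 (PP t) (PP (t + 1))
      + Idiv2 V (W (t + 1) ** H (t + 1)) + Idiv3 (QQ (t + 1)) (QQ t)"
    using Idiv2_alternating_step[OF V_nonneg Wt Ht supp]
    unfolding mt mt' P_step[OF t'] Q_step[OF t] P_step[OF t] Qt .
  moreover have "Idiv2 V (W (t + 1) ** H (t + 1)) \<le> Idiv2 V (W t ** H t)"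
  proof -
    have "0 \<le> Idiv3 (PP t) (PP (t + 1))" "0 \<le> Idiv3 (QQ (t + 1)) (QQ t)"
      using nnP[OF t] nnP[OF t'] nnQ[OF t] nnQ[OF t'] by (auto intro: Idiv3_nonneg)
    then show ?thesis
      unfolding D by (metis add_increasing add_increasing2 order_refl)
  qed
  ultimately show "(\<forall>i l. W (t + 1) $ i $ l =
         (\<Sum>j\<in>UNIV. V $ i $ j * (W t $ i $ l * H t $ l $ j / (W t ** H t) $ i $ j)))
    \<and> (\<forall>l j.
         0 < (\<Sum>i\<in>UNIV. \<Sum>j'\<in>UNIV. V $ i $ j' * (W t $ i $ l * H t $ l $ j') / (W t ** H t) $ i $ j')
         \<longrightarrow> H (t + 1) $ l $ j =
           (\<Sum>i\<in>UNIV. V $ i $ j * (W t $ i $ l * H t $ l $ j) / (W t ** H t) $ i $ j) /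
           (\<Sum>i\<in>UNIV. \<Sum>j'\<in>UNIV. V $ i $ j' * (W t $ i $ l * H t $ l $ j') / (W t ** H t) $ i $ j'))
    \<and> Idiv2 V (W t ** H t) =
         Idiv3 (PP t) (PP (t + 1)) + Idiv2 V (W (t + 1) ** H (t + 1)) + Idiv3 (QQ (t + 1)) (QQ t)
    \<and> Idiv2 V (W (t + 1) ** H (t + 1)) \<le> Idiv2 V (W t ** H t)"
    unfolding PPt by blast
qed

end
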